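(* Assume the abc conjecture holds. Let $c_5>0$ and $W>0$ be constants. Then there is a constant $C$ such that the number of non-constant arithmetic progressions $h_0,\dots,h_{k-1}$ in $G_!$, with $h_i=l_i!\,x_i^{l_i}$ $(0\le i\le k-1)$, satisfying $\gcd(h_0,h_1)\le c_5$, $\omega(d)\le W$ where $d=h_1-h_0$, $k\ge3$, and $l_i\ge4$ for all $i$, is at most $C$.
   Context: For a non-zero integer $y$, $N(y)=\prod_{p\mid y}p$ (product over the distinct primes dividing $y$), and $\omega(y)$ is the number of distinct prime divisors of $y$. abc conjecture: for every $\epsilon>0$ there is a constant $K(\epsilon)$ depending only on $\epsilon$ such that whenever $a,b,c$ are coprime non-zero integers with $a+b=c$, one has $c<K(\epsilon)N(abc)^{1+\epsilon}$. $G_!=\{l!\,x^l\mid x,l\in\mathbb{Z},\ x>0,\ l\ge2\}$. The length $k$ and the exponents $l_i\geq 2$ (and $x_i>0$) may vary with the progression. *)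

theory Defs
  imports Complex_Main "HOL-Computational_Algebra.Primes"
begin

text \<open>On integers \<open>prime_factors y\<close> consists of the positive primes dividing \<open>y\<close>, for \<open>y \<noteq> 0\<close>.\<close>

definition rad :: "int \<Rightarrow> int" where
  "rad y = \<Prod>(prime_factors y)"

definition omega :: "int \<Rightarrow> nat" where
  "omega y = card (prime_factors y)"

text \<open>Coprimality of the triple means joint coprimality, which for \<open>a + b = c\<close> is the same as
  pairwise coprimality.\<close>

definition abc_conjecture :: bool where
  "abc_conjecture \<longleftrightarrow>
     (\<forall>\<epsilon>::real. \<epsilon> > 0 \<longrightarrow>
       (\<exists>K::real. \<forall>a b c :: int.
          a \<noteq> 0 \<longrightarrow> b \<noteq> 0 \<longrightarrow> c \<noteq> 0 \<longrightarrow> Gcd {a, b, c} = 1 \<longrightarrow> a + b = c \<longrightarrow>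
          real_of_int c < K * real_of_int (rad (a * b * c)) powr (1 + \<epsilon>)))"

definition G_fact :: "int set" where
  "G_fact = {fact l * x ^ l | (x::int) (l::nat). x > 0 \<and> l \<ge> 2}"

definition arith_progression :: "int list \<Rightarrow> bool" where
  "arith_progression hs \<longleftrightarrow> (\<exists>a d. \<forall>i<length hs. hs ! i = a + int i * d)"

definition constant_list :: "'a list \<Rightarrow> bool" where
  "constant_list hs \<longleftrightarrow> (\<forall>x\<in>set hs. \<forall>y\<in>set hs. x = y)"

end

theory Submission
  imports Defs
begin

text \<open>
  A term \<open>h = l! x\<^sup>l\<close> with \<open>l \<ge> 4\<close> has a small radical: \<open>rad h \<le> C h\<^sup>1\<^sup>/\<^sup>4\<close> with a constant \<open>C\<close>
  that depends neither on \<open>l\<close> nor on \<open>x\<close>.  The power contributes at most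
  \<open>x \<le> (x\<^sup>l)\<^sup>1\<^sup>/\<^sup>4\<close>, and the factorial contributes the product of the primes up to \<open>l\<close>, which by
  Chebyshev's argument is at most \<open>4\<^sup>l\<close> and hence negligible against \<open>l!\<close>.

  Let \<open>u, v, w\<close> be consecutive terms of the progression, so that \<open>u + w = 2v\<close>.  The greatest
  common divisor of two consecutive terms is the same throughout the progression, so dividing
  this relation by its common factor, which is at most \<open>2c\<^sub>5\<close>, gives a coprime \<open>abc\<close> triple with
  \<open>c\<close> of order \<open>v\<close>.  The radical of its product is \<open>O(v\<^sup>3\<^sup>/\<^sup>4)\<close>, so the \<open>abc\<close> conjecture with
  \<open>\<epsilon> = 1/6\<close> gives \<open>v = O(v\<^sup>7\<^sup>/\<^sup>8)\<close>, an absolute bound for \<open>v\<close>.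

  Applied to every interior term, this bounds all terms of the progression, not only the first
  three: \<open>u\<close> and \<open>w\<close> are positive, hence smaller than \<open>2v\<close>.  Since the terms are distinct, the
  length is bounded as well, and only finitely many progressions remain.
\<close>

section \<open>Radicals\<close>

lemma prod_primes_dvd:
  fixes n :: "'a :: factorial_semiring_gcd"
  assumes "finite A" "\<And>p. p \<in> A \<Longrightarrow> prime p \<and> p dvd n"
  shows "\<Prod>A dvd n"
  using assms
proof (induction A rule: finite_induct)
  case (insert p A)
  have "coprime p (\<Prod>A)"
    using insert by (intro prod_coprime_right) (metis insertCI primes_coprime)
  thus ?case using insert by (auto intro: divides_mult)
qed auto

lemma rad_pos: "rad y \<ge> 1"
proof -
  have "rad y > 0"
    unfolding rad_def by (intro prod_pos) (auto dest: in_prime_factors_imp_prime prime_gt_0_int)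
  thus ?thesis by simp
qed

lemma rad_le_self:
  assumes "y > 0"
  shows "rad y \<le> y"
proof -
  have "rad y dvd y"
    unfolding rad_def by (rule prod_primes_dvd) auto
  thus ?thesis using assms by (rule zdvd_imp_le)
qed

lemma rad_dvd_mono:
  assumes "a dvd b" "b \<noteq> 0"
  shows "rad a \<le> rad b"
  unfolding rad_def using assms
  by (intro prod_mono2 dvd_prime_factors)
     (auto dest!: in_prime_factors_imp_prime simp: prime_ge_0_int dest: prime_ge_1_int)

lemma rad_mult_le:
  assumes "a \<noteq> 0" "b \<noteq> 0"
  shows "rad (a * b) \<le> rad a * rad b"
proof -
  let ?A = "prime_factors a" and ?B = "prime_factors b"
  have "1 \<le> \<Prod>(?A \<inter> ?B)"
    by (intro prod_ge_1) (auto dest!: in_prime_factors_imp_prime dest: prime_ge_1_int)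
  moreover have "\<Prod>(?A \<union> ?B) * \<Prod>(?A \<inter> ?B) = rad a * rad b"
    unfolding rad_def by (rule prod.union_inter) auto
  moreover have "rad (a * b) = \<Prod>(?A \<union> ?B)"
    unfolding rad_def using assms by (simp add: prime_factors_product)
  ultimately show ?thesis
    using rad_pos[of "a * b"] mult_left_mono[of 1 "\<Prod>(?A \<inter> ?B)" "\<Prod>(?A \<union> ?B)"] by simp
qed

lemma rad_power_le: "rad (x ^ n) \<le> rad x"
proof -
  have "prime_factors (x ^ n) \<subseteq> prime_factors x"
    by (cases "x = 0") (auto simp: prime_factors_dvd power_0_left dest: prime_dvd_power)
  thus ?thesis
    unfolding rad_def
    by (intro prod_mono2)
       (auto dest!: in_prime_factors_imp_prime dest: prime_ge_1_int simp: prime_ge_0_int)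
qed

section \<open>The radical of a factorial times a power\<close>

text \<open>
  Every prime in \<open>(m + 1, 2m + 1]\<close> divides the numerator \<open>(2m + 1)!\<close> of the binomial coefficient
  below but not its denominator \<open>m! (m + 1)!\<close>.
\<close>
lemma prod_primes_upper_half_le:
  "\<Prod>{p::nat. prime p \<and> m + 1 < p \<and> p \<le> 2 * m + 1} \<le> 4 ^ m"
proof -
  let ?b = "(2 * m + 1) choose m"
  have "\<Prod>{p::nat. prime p \<and> m + 1 < p \<and> p \<le> 2 * m + 1} dvd ?b"
  proof (rule prod_primes_dvd)
    fix p :: nat
    assume "p \<in> {p. prime p \<and> m + 1 < p \<and> p \<le> 2 * m + 1}"
    hence p: "prime p" "m + 1 < p" "p \<le> 2 * m + 1" by auto
    have "fact m * fact (m + 1) * ?b = (fact (2 * m + 1) :: nat)"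
      using binomial_fact_lemma[of m "2 * m + 1"] by (simp add: algebra_simps)
    moreover have "p dvd (fact (2 * m + 1) :: nat)"
      using p prime_dvd_fact_iff by blast
    moreover have "\<not> p dvd (fact m :: nat)" "\<not> p dvd (fact (m + 1) :: nat)"
      using p prime_dvd_fact_iff[of p] by (auto simp del: fact_Suc)
    ultimately show "prime p \<and> p dvd ?b"
      using p(1) by (metis prime_dvd_mult_iff)
  qed auto
  moreover have "?b > 0" by simp
  ultimately have "\<Prod>{p::nat. prime p \<and> m + 1 < p \<and> p \<le> 2 * m + 1} \<le> ?b"
    by (rule dvd_imp_le)
  \<comment> \<open>The two equal middle coefficients together are at most \<open>2\<^sup>2\<^sup>m\<^sup>+\<^sup>1\<close>, which saves the factor 2.\<close>
  also have "2 * ?b \<le> 2 ^ (2 * m + 1)"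
  proof -
    have "?b = (2 * m + 1) choose (m + 1)"
      using binomial_symmetric[of m "2 * m + 1"] by simp
    hence "2 * ?b = (\<Sum>k\<in>{m, m + 1}. (2 * m + 1) choose k)" by simp
    also have "\<dots> \<le> (\<Sum>k\<le>2 * m + 1. (2 * m + 1) choose k)"
      by (rule sum_mono2) auto
    finally show ?thesis by (simp only: choose_row_sum)
  qed
  hence "?b \<le> 4 ^ m" by (simp add: power_mult)
  finally show ?thesis .
qed

text \<open>
  An odd \<open>n = 2m + 1\<close> is split at \<open>m + 1\<close>, so that the two bounds multiply to exactly
  \<open>4\<^sup>m\<^sup>+\<^sup>1 4\<^sup>m = 4\<^sup>n\<close>; an even \<open>n > 2\<close> is not prime and reduces to \<open>n - 1\<close>.
\<close>
lemma prod_primes_le_four_power: "\<Prod>{p::nat. prime p \<and> p \<le> n} \<le> 4 ^ n"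
proof (induction n rule: less_induct)
  case (less n)
  consider "n \<le> 1" | "n = 2" | "n > 2" "even n" | "n > 2" "odd n" by linarith
  thus ?case
  proof cases
    case 1
    hence "{p::nat. prime p \<and> p \<le> n} = {}" by (auto dest: prime_ge_2_nat)
    thus ?thesis by (simp only: prod.empty) simp
  next
    case 2
    have "{p::nat. prime p \<and> p \<le> n} = {2}"
      using 2 by (auto dest: prime_ge_2_nat)
    thus ?thesis using 2 by simp
  next
    case 3
    have "\<not> prime n" using 3 primes_dvd_imp_eq two_is_prime_nat by blast
    hence "{p::nat. prime p \<and> p \<le> n} = {p. prime p \<and> p \<le> n - 1}"
      using 3 by (auto simp: le_less)
    hence "\<Prod>{p::nat. prime p \<and> p \<le> n} \<le> 4 ^ (n - 1)"
      using less.IH[of "n - 1"] 3 by simp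
    also have "\<dots> \<le> 4 ^ n" by (rule power_increasing) auto
    finally show ?thesis .
  next
    case 4
    then obtain m where m: "n = 2 * m + 1" "m \<ge> 1" by (auto elim!: oddE)
    let ?L = "{p::nat. prime p \<and> p \<le> m + 1}"
    let ?U = "{p::nat. prime p \<and> m + 1 < p \<and> p \<le> 2 * m + 1}"
    have "{p::nat. prime p \<and> p \<le> n} = ?L \<union> ?U" using m by auto
    hence "\<Prod>{p::nat. prime p \<and> p \<le> n} = \<Prod>?L * \<Prod>?U"
      by (simp only:) (rule prod.union_disjoint, auto)
    also have "\<dots> \<le> 4 ^ (m + 1) * 4 ^ m"
      using m by (intro mult_mono less.IH prod_primes_upper_half_le) auto
    also have "\<dots> = 4 ^ n" using m by (simp flip: power_add add: mult_2)
    finally show ?thesis .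
  qed
qed

lemma rad_fact_le: "rad (fact l) \<le> 4 ^ l"
proof -
  have "prime_factors (fact l :: int) \<subseteq> int ` {p. prime p \<and> p \<le> l}"
  proof
    fix p :: int
    assume "p \<in> prime_factors (fact l)"
    hence p: "prime p" "p dvd fact l" by auto
    then obtain q where q: "p = int q" using prime_ge_0_int nonneg_int_cases by metis
    have "int q dvd int (fact l)" using p(2) by (simp add: q)
    hence "q dvd fact l" by (simp only: int_dvd_int_iff)
    moreover have "prime q" using p(1) q by simp
    ultimately show "p \<in> int ` {p. prime p \<and> p \<le> l}"
      using q prime_dvd_fact_iff by blast
  qed
  hence "rad (fact l) \<le> \<Prod>(int ` {p. prime p \<and> p \<le> l})"
    unfolding rad_def by (intro prod_mono2) (auto dest: prime_ge_1_nat)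
  also have "\<dots> = int (\<Prod>{p. prime p \<and> p \<le> l})"
    by (simp add: prod.reindex)
  also have "\<dots> \<le> int (4 ^ l)"
    by (simp only: of_nat_le_iff prod_primes_le_four_power)
  finally show ?thesis by simp
qed

lemma power_le_const_mult_fact:
  fixes a :: real
  shows "\<exists>C>0. \<forall>n. a ^ n \<le> C * fact n"
proof -
  have "Bseq (\<lambda>n. inverse (fact n) * a ^ n)"
    using summable_exp[of a] by (intro convergent_imp_Bseq convergentI) (rule summable_LIMSEQ_zero)
  then obtain C where "C > 0" "\<And>n. norm (inverse (fact n) * a ^ n) \<le> C"
    by (auto elim: BseqE)
  hence "inverse (fact n) * a ^ n \<le> C" for n
    by (metis abs_le_D1 real_norm_def)
  hence "a ^ n \<le> C * fact n" for n
    by (simp add: field_simps)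
  thus ?thesis using \<open>C > 0\<close> by blast
qed

text \<open>
  The fourth power keeps the estimate in the integers: the factorial contributes
  \<open>(4\<^sup>l)\<^sup>4 = 256\<^sup>l = O(l!)\<close>, and \<open>x\<^sup>4 \<le> x\<^sup>l\<close> is where \<open>l \<ge> 4\<close> enters.
\<close>
lemma rad_fact_mult_power_small:
  "\<exists>C::real>0. \<forall>l x. l \<ge> 4 \<longrightarrow> x > 0 \<longrightarrow>
     real_of_int (rad (fact l * x ^ l)) ^ 4 \<le> C * real_of_int (fact l * x ^ l)"
proof -
  obtain C :: real where C: "C > 0" "\<And>n. 256 ^ n \<le> C * fact n"
    using power_le_const_mult_fact by blast
  have "real_of_int (rad (fact l * x ^ l)) ^ 4 \<le> C * real_of_int (fact l * x ^ l)"
    if lx: "l \<ge> 4" "x > 0" for l x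
  proof -
    have "rad (fact l * x ^ l) \<le> rad (fact l) * rad (x ^ l)"
      using lx by (intro rad_mult_le) auto
    also have "\<dots> \<le> 4 ^ l * x"
      using lx rad_power_le[of x l] rad_le_self[of x] rad_pos[of "x ^ l"]
      by (intro mult_mono rad_fact_le) auto
    finally have "rad (fact l * x ^ l) ^ 4 \<le> (4 ^ l * x) ^ 4"
      using rad_pos[of "fact l * x ^ l"] by (intro power_mono) auto
    also have "\<dots> = 256 ^ l * x ^ 4"
    proof -
      have "((4::int) ^ l) ^ 4 = (4 ^ 4) ^ l" by (metis power_mult mult.commute)
      thus ?thesis by (simp add: power_mult_distrib)
    qed
    also have "\<dots> \<le> 256 ^ l * x ^ l"
      using lx by (intro mult_left_mono power_increasing) auto
    finally have "real_of_int (rad (fact l * x ^ l) ^ 4) \<le> real_of_int (256 ^ l * x ^ l)"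
      by (simp only: of_int_le_iff)
    hence "real_of_int (rad (fact l * x ^ l)) ^ 4 \<le> 256 ^ l * real_of_int x ^ l"
      by simp
    also have "\<dots> \<le> (C * fact l) * real_of_int x ^ l"
      using lx by (intro mult_right_mono C) auto
    finally show ?thesis by (simp add: mult.assoc)
  qed
  thus ?thesis using C(1) by blast
qed

section \<open>Three consecutive terms\<close>

lemma powr_of_power:
  fixes x :: real
  assumes "x > 0"
  shows "(x ^ n) powr a = x powr (real n * a)"
  using assms by (metis powr_powr powr_realpow)

text \<open>
  Here \<open>u + w = 2v\<close> is divided by \<open>g = gcd u (2v)\<close> to obtain a coprime triple.  The radical of
  \<open>2uvw\<close> is \<open>O(v\<^sup>3\<^sup>/\<^sup>4)\<close>, and any \<open>\<epsilon> < 1/3\<close> would keep the exponent \<open>3/4 (1 + \<epsilon>)\<close> below 1.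
\<close>
lemma abc_bounds_three_term_progression:
  fixes c C :: real
  assumes abc: "abc_conjecture" and c: "c > 0" and C: "C > 0"
  shows "\<exists>B::int. \<forall>u v w. u > 0 \<longrightarrow> v > 0 \<longrightarrow> w > 0 \<longrightarrow> u + w = 2 * v \<longrightarrow>
           real_of_int (gcd u v) \<le> c \<longrightarrow>
           (\<forall>h\<in>{u, v, w}. real_of_int (rad h) ^ 4 \<le> C * real_of_int h) \<longrightarrow> v \<le> B"
proof -
  obtain K :: real where K: "\<And>a b d. a \<noteq> 0 \<Longrightarrow> b \<noteq> 0 \<Longrightarrow> d \<noteq> 0 \<Longrightarrow> Gcd {a, b, d} = 1 \<Longrightarrow>
      a + b = d \<Longrightarrow> real_of_int d < K * real_of_int (rad (a * b * d)) powr (1 + 1/6)"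
    using abc unfolding abc_conjecture_def by (metis zero_less_divide_1_iff zero_less_numeral)
  define D where "D = 64 * C ^ 3"
  define M where "M = c * \<bar>K\<bar> * D powr (7/24)"
  have "v \<le> \<lceil>M ^ 8\<rceil>"
    if pos: "u > 0" "v > 0" "w > 0" and sum: "u + w = 2 * v" and gcd_le: "real_of_int (gcd u v) \<le> c"
      and small: "\<forall>h\<in>{u, v, w}. real_of_int (rad h) ^ 4 \<le> C * real_of_int h" for u v w :: int
  proof -
    define g where "g = gcd u (2 * v)"
    have g: "g > 0" using pos by (simp add: g_def)
    obtain a where a: "u = g * a" unfolding g_def by (metis dvdE gcd_dvd1)
    obtain d where d: "2 * v = g * d" unfolding g_def by (metis dvdE gcd_dvd2)
    define b where "b = d - a"
    have w: "w = g * b" using sum a d by (simp add: b_def algebra_simps)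
    have abd: "a > 0" "b > 0" "d > 0"
      using pos a d w g by (metis mult_pos_pos zero_less_mult_pos zero_less_numeral)+
    have "gcd a d = 1"
    proof -
      have "g * gcd a d = gcd (g * a) (g * d)"
        using g by (simp add: gcd_mult_left)
      also have "\<dots> = g" using a d g_def by metis
      finally have "g * gcd a d = g" .
      thus ?thesis using g by simp
    qed
    moreover have "Gcd {a, b, d} dvd gcd a d" by (intro gcd_greatest Gcd_dvd) auto
    ultimately have Gcd1: "Gcd {a, b, d} = 1" by (simp del: Gcd_insert)
    have "a + b = d" by (simp add: b_def)
    hence d_less: "real_of_int d < K * real_of_int (rad (a * b * d)) powr (7/6)"
      using K[OF _ _ _ Gcd1] abd by simp

    define R where "R = real_of_int (rad (a * b * d))"
    have R: "R \<ge> 1" unfolding R_def using rad_pos by simp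
    define r where "r = rad u * rad w * rad v"
    have "rad (a * b * d) \<le> rad (u * w * (2 * v))"
      using pos abd by (intro rad_dvd_mono mult_dvd_mono) (auto simp: a w d)
    also have "\<dots> = rad (2 * (u * w * v))" by (simp add: ac_simps)
    also have "\<dots> \<le> rad 2 * rad (u * w * v)"
      using pos by (intro rad_mult_le) auto
    also have "\<dots> \<le> 2 * r"
    proof (rule mult_mono)
      have "rad (u * w * v) \<le> rad (u * w) * rad v"
        using pos by (intro rad_mult_le) auto
      also have "\<dots> \<le> rad u * rad w * rad v"
        using pos rad_pos[of v] by (intro mult_right_mono rad_mult_le) auto
      finally show "rad (u * w * v) \<le> r" by (simp add: r_def)
    qed (use rad_le_self[of 2] rad_pos[of "u * w * v"] in auto)
    finally have "R \<le> 2 * real_of_int r" unfolding R_def by linarith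
    hence "R ^ 4 \<le> (2 * real_of_int r) ^ 4"
      using R by (intro power_mono) auto
    also have "\<dots> = 16 * (real_of_int (rad u) ^ 4 * real_of_int (rad w) ^ 4 * real_of_int (rad v) ^ 4)"
      by (simp add: r_def power_mult_distrib)
    also have "\<dots> \<le> 16 * ((C * (2 * v)) * (C * (2 * v)) * (C * v))"
    proof -
      have "C * real_of_int u \<le> C * (2 * v)" "C * real_of_int w \<le> C * (2 * v)"
        using sum pos C by (auto intro!: mult_left_mono)
      hence "real_of_int (rad u) ^ 4 \<le> C * (2 * v)" "real_of_int (rad w) ^ 4 \<le> C * (2 * v)"
        "real_of_int (rad v) ^ 4 \<le> C * v"
        using small by (auto intro: order_trans)
      thus ?thesis using C pos by (intro mult_left_mono mult_mono) auto
    qed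
    also have "\<dots> = D * real_of_int v ^ 3"
      by (simp add: D_def power3_eq_cube)
    finally have R4: "R ^ 4 \<le> D * real_of_int v ^ 3" .

    have v: "real_of_int v > 0" using pos by simp
    have "R powr (7/6) = (R ^ 4) powr (7/24)"
      using R by (simp add: powr_of_power)
    also have "\<dots> \<le> (D * real_of_int v ^ 3) powr (7/24)"
      using R R4 by (intro powr_mono2) auto
    also have "\<dots> = D powr (7/24) * real_of_int v powr (7/8)"
      using v C by (simp add: D_def powr_mult powr_of_power)
    finally have R_le: "R powr (7/6) \<le> D powr (7/24) * real_of_int v powr (7/8)" .

    have "g \<le> 2 * gcd u v"
    proof (rule zdvd_imp_le)
      have "g dvd 2 * u" "g dvd 2 * v" by (auto simp: g_def)
      hence "g dvd gcd (2 * u) (2 * v)" by (rule gcd_greatest)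
      thus "g dvd 2 * gcd u v" by (simp add: gcd_mult_left)
    qed (use pos in auto)
    hence g_le: "real_of_int g \<le> 2 * c" using gcd_le by linarith
    have "2 * real_of_int v = real_of_int g * real_of_int d"
      using d by (metis of_int_mult of_int_numeral)
    also have "\<dots> \<le> (2 * c) * real_of_int d"
      using g_le abd by (intro mult_right_mono) auto
    also have "\<dots> \<le> (2 * c) * (\<bar>K\<bar> * R powr (7/6))"
    proof (intro mult_left_mono)
      have "real_of_int d \<le> K * R powr (7/6)" using d_less by (simp add: R_def)
      also have "\<dots> \<le> \<bar>K\<bar> * R powr (7/6)" by (intro mult_right_mono) auto
      finally show "real_of_int d \<le> \<bar>K\<bar> * R powr (7/6)" .
    qed (use c in auto)
    also have "\<dots> \<le> (2 * c) * (\<bar>K\<bar> * (D powr (7/24) * real_of_int v powr (7/8)))"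
      using c R_le by (intro mult_left_mono) auto
    also have "\<dots> = 2 * (M * real_of_int v powr (7/8))"
      by (simp add: M_def)
    finally have "real_of_int v \<le> M * real_of_int v powr (7/8)" by simp
    moreover have "real_of_int v = real_of_int v powr (1/8) * real_of_int v powr (7/8)"
      using v by (simp flip: powr_add)
    ultimately have "real_of_int v powr (1/8) * real_of_int v powr (7/8)
                       \<le> M * real_of_int v powr (7/8)" by simp
    hence "real_of_int v powr (1/8) \<le> M"
      using v by simp
    hence "(real_of_int v powr (1/8)) ^ 8 \<le> M ^ 8"
      by (intro power_mono) auto
    moreover have "(real_of_int v powr (1/8)) ^ 8 = real_of_int v"
      using v by (simp add: powr_power)
    ultimately show ?thesis by linarith
  qed
  thus ?thesis by blast
qed

section \<open>Finiteness of the set of progressions\<close>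

theorem theorem5:
  fixes c\<^sub>5 W :: real
  assumes "abc_conjecture"
    and "c\<^sub>5 > 0" and "W > 0"
  shows "\<exists>C::nat.
    let P = {hs :: int list.
          length hs \<ge> 3 \<and> arith_progression hs \<and> \<not> constant_list hs \<and> set hs \<subseteq> G_fact \<and>
          (\<exists>(l :: nat \<Rightarrow> nat) (x :: nat \<Rightarrow> int). \<forall>i<length hs.
              hs ! i = fact (l i) * x i ^ l i \<and> x i > 0 \<and> l i \<ge> 4) \<and>
          real_of_int (gcd (hs ! 0) (hs ! 1)) \<le> c\<^sub>5 \<and>
          real (omega (hs ! 1 - hs ! 0)) \<le> W}
    in finite P \<and> card P \<le> C"
proof -
  obtain A :: real where A: "A > 0" "\<And>l x. l \<ge> 4 \<Longrightarrow> x > 0 \<Longrightarrow>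
      real_of_int (rad (fact l * x ^ l)) ^ 4 \<le> A * real_of_int (fact l * x ^ l)"
    using rad_fact_mult_power_small by blast
  obtain B :: int where B: "\<And>u v w. u > 0 \<Longrightarrow> v > 0 \<Longrightarrow> w > 0 \<Longrightarrow> u + w = 2 * v \<Longrightarrow>
      real_of_int (gcd u v) \<le> c\<^sub>5 \<Longrightarrow>
      \<forall>h\<in>{u, v, w}. real_of_int (rad h) ^ 4 \<le> A * real_of_int h \<Longrightarrow> v \<le> B"
    using abc_bounds_three_term_progression[OF assms(1,2) A(1)] by metis
  define Q where "Q = {hs :: int list. set hs \<subseteq> {1..2 * B} \<and> length hs \<le> nat (2 * B)}"
  define P where "P = {hs :: int list.
          length hs \<ge> 3 \<and> arith_progression hs \<and> \<not> constant_list hs \<and> set hs \<subseteq> G_fact \<and>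
          (\<exists>(l :: nat \<Rightarrow> nat) (x :: nat \<Rightarrow> int). \<forall>i<length hs.
              hs ! i = fact (l i) * x i ^ l i \<and> x i > 0 \<and> l i \<ge> 4) \<and>
          real_of_int (gcd (hs ! 0) (hs ! 1)) \<le> c\<^sub>5 \<and>
          real (omega (hs ! 1 - hs ! 0)) \<le> W}"
  have "P \<subseteq> Q"
  proof
    fix hs :: "int list"
    assume "hs \<in> P"
    then obtain l x where len: "length hs \<ge> 3" and "arith_progression hs"
      and nonconst: "\<not> constant_list hs"
      and gcd_le: "real_of_int (gcd (hs ! 0) (hs ! 1)) \<le> c\<^sub>5"
      and lx: "\<And>i. i < length hs \<Longrightarrow> hs ! i = fact (l i) * x i ^ l i \<and> x i > 0 \<and> l i \<ge> (4::nat)"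
      unfolding P_def by auto
    then obtain a d where hs: "\<And>i. i < length hs \<Longrightarrow> hs ! i = a + int i * d"
      unfolding arith_progression_def by blast
    have d: "d \<noteq> 0"
      using nonconst hs by (auto simp: constant_list_def in_set_conv_nth)
    have pos: "hs ! i > 0" if "i < length hs" for i
      using lx[OF that] by simp
    have small: "real_of_int (rad (hs ! i)) ^ 4 \<le> A * real_of_int (hs ! i)" if "i < length hs" for i
      using lx[OF that] A(2)[of "l i" "x i"] by simp
    \<comment> \<open>Consecutive terms have greatest common divisor \<open>gcd(h\<^sub>i, d) = gcd(a, d)\<close> for every \<open>i\<close>.\<close>
    have gcd_consecutive: "gcd (hs ! i) (hs ! Suc i) = gcd a d" if "Suc i < length hs" for i
    proof -
      have "gcd (hs ! i) (hs ! Suc i) = gcd (a + int i * d) ((a + int i * d) + d)"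
        using that hs[of i] hs[of "Suc i"] by (simp add: algebra_simps)
      also have "\<dots> = gcd d (int i * d + a)"
        by (subst gcd_add2) (simp only: gcd.commute add.commute)
      finally show ?thesis by (simp only: gcd_add_mult gcd.commute)
    qed
    have interior: "u + w = 2 * v \<and> u > 0 \<and> w > 0 \<and> v \<le> B"
      if "Suc (Suc i) < length hs" "u = hs ! i" "v = hs ! Suc i" "w = hs ! Suc (Suc i)" for i u v w
    proof -
      have "u + w = 2 * v"
        using that hs[of i] hs[of "Suc i"] hs[of "Suc (Suc i)"] by (simp add: algebra_simps)
      moreover have "real_of_int (gcd u v) \<le> c\<^sub>5"
        using gcd_le gcd_consecutive[of 0] gcd_consecutive[of i] that len by simp
      moreover have "u > 0" "v > 0" "w > 0" using pos that by auto
      moreover have "\<forall>h\<in>{u, v, w}. real_of_int (rad h) ^ 4 \<le> A * real_of_int h"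
        using small that by auto
      ultimately show ?thesis using B[of u v w] by simp
    qed
    have bounded: "hs ! i \<le> 2 * B" if "i < length hs" for i
    proof (cases "Suc (Suc i) < length hs")
      case True
      show ?thesis using interior[OF True refl refl refl] by linarith
    next
      case False
      \<comment> \<open>One of the last two terms: it is the middle or the last term of a triple.\<close>
      define j where "j = length hs - 3"
      have j: "Suc (Suc j) < length hs" "i = Suc j \<or> i = Suc (Suc j)"
        using False that len by (auto simp: j_def)
      show ?thesis using interior[OF j(1) refl refl refl] j(2) by auto
    qed
    have range: "set hs \<subseteq> {1..2 * B}"
      using pos bounded by (force simp: in_set_conv_nth)
    have "distinct hs"
      using hs d by (auto simp: distinct_conv_nth)
    hence "length hs = card (set hs)" by (simp add: distinct_card)
    also have "\<dots> \<le> nat (2 * B)"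
      using card_mono[OF _ range] by simp
    finally show "hs \<in> Q" using range by (simp add: Q_def)
  qed
  moreover have "finite Q"
    unfolding Q_def by (rule finite_lists_length_le) simp
  ultimately have "finite P \<and> card P \<le> card Q"
    by (simp add: card_mono finite_subset)
  thus ?thesis
    unfolding P_def Let_def by blast
qed

end
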